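(* Let $k$ be an algebraically closed field of characteristic $p>0$. Let $M=\mathbb{Z}^d$ be a free abelian group of rank $d$ and let $A\subset M$ be a finitely generated submonoid which generates $M$ as a group and which contains no nontrivial group. Then the monoid algebra $k[A]$ is F-pure if and only if it is weakly normal.
   Context: The monoid algebra is $k[A]=\bigoplus_{m\in A}k\cdot x^m\subset k[M]=\bigoplus_{m\in M}k\cdot x^m$. For a finitely generated $k$-algebra $R$ that is an integral domain with fraction field $K$, let $R^{1/p}\subset K^{1/p}$ denote the ring of $p$-th roots of elements of $R$ (in an algebraic closure of $K$). $R$ is F-pure if the inclusion $R\hookrightarrow R^{1/p}$ locally (on $\operatorname{Spec}R$) splits as a morphism of $R$-modules. $R$ is weakly normal if $R=R^{1/p}\cap K$. *)

theory Defs
  imports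
    "HOL-Algebra.Free_Abelian_Groups"
    "HOL-Algebra.Generated_Groups"
    "HOL-Algebra.Algebraic_Closure_Type"
    "HOL-Computational_Algebra.Polynomial_Factorial"
begin

section \<open>F-purity and weak normality\<close>

text \<open>
  An integral domain is represented by a subring \<open>R\<close> of an algebraically closed field \<open>\<Omega>\<close>
  (a type of class \<^class>\<open>alg_closed_field\<close>). Its fraction field \<open>K\<close>, the ring \<open>R\<^sup>1\<^sup>/\<^sup>p\<close> and all
  localizations are then subsets of \<open>\<Omega>\<close>. An element \<open>y\<close> with \<open>y ^ p \<in> R\<close> is algebraic over
  \<open>K\<close>, so \<open>R\<^sup>1\<^sup>/\<^sup>p\<close> lies in the algebraic closure of \<open>K\<close> in \<open>\<Omega>\<close>, even if \<open>\<Omega>\<close> is larger.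
\<close>

definition frac_field :: "'w::alg_closed_field set \<Rightarrow> 'w set" where
  "frac_field R = {a / b | a b. a \<in> R \<and> b \<in> R \<and> b \<noteq> 0}"

definition root_ring :: "nat \<Rightarrow> 'w::alg_closed_field set \<Rightarrow> 'w set" where
  "root_ring p R = {y. y ^ p \<in> R}"

definition weakly_normal :: "nat \<Rightarrow> 'w::alg_closed_field set \<Rightarrow> bool" where
  "weakly_normal p R \<longleftrightarrow> R = root_ring p R \<inter> frac_field R"

text \<open>The localization \<open>S[1/f]\<close> inside \<open>\<Omega>\<close>; only meaningful for \<open>f \<noteq> 0\<close>.\<close>

definition localize_at :: "'w::alg_closed_field \<Rightarrow> 'w set \<Rightarrow> 'w set" where
  "localize_at f S = {y / f ^ n | y n. y \<in> S}"

text \<open>The inclusion \<open>R \<subseteq> S\<close> splits as a morphism of \<open>R\<close>-modules.\<close>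

definition inclusion_splits :: "'w::alg_closed_field set \<Rightarrow> 'w set \<Rightarrow> bool" where
  "inclusion_splits R S \<longleftrightarrow> (\<exists>\<phi> :: 'w \<Rightarrow> 'w.
     (\<forall>y\<in>S. \<phi> y \<in> R) \<and>
     (\<forall>x\<in>S. \<forall>y\<in>S. \<phi> (x + y) = \<phi> x + \<phi> y) \<and>
     (\<forall>a\<in>R. \<forall>y\<in>S. \<phi> (a * y) = a * \<phi> y) \<and>
     (\<forall>a\<in>R. \<phi> a = a))"

text \<open>
  Locally on \<open>Spec R\<close>: every prime \<open>P\<close> has a basic open neighbourhood \<open>D(f)\<close>, i.e.
  \<open>f \<in> R - P\<close>, over which the inclusion \<open>R[1/f] \<subseteq> R\<^sup>1\<^sup>/\<^sup>p[1/f]\<close> splits.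
\<close>

definition F_pure :: "nat \<Rightarrow> 'w::alg_closed_field set \<Rightarrow> bool" where
  "F_pure p R \<longleftrightarrow>
     (\<forall>P. primeideal P (ring_of_type_algebra\<lparr>carrier := R\<rparr>) \<longrightarrow>
        (\<exists>f \<in> R - P. inclusion_splits (localize_at f R) (localize_at f (root_ring p R))))"


section \<open>Monoids in \<open>\<int>\<^sup>d\<close> and their algebras\<close>

text \<open>\<open>\<int>\<^sup>d\<close>, for arbitrary \<open>d \<ge> 0\<close>, as a subgroup of the finitely supported functions on \<open>nat\<close>.\<close>

abbreviation lattice_group :: "nat \<Rightarrow> (nat \<Rightarrow>\<^sub>0 int) monoid" where
  "lattice_group d \<equiv> free_Abelian_group {..<d}"

definition submonoid_generated :: "('a, 'b) monoid_scheme \<Rightarrow> 'a set \<Rightarrow> 'a set" where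
  "submonoid_generated G B = \<Inter>{S. submonoid S G \<and> B \<subseteq> S}"

definition finitely_generated_submonoid :: "'a set \<Rightarrow> ('a, 'b) monoid_scheme \<Rightarrow> bool" where
  "finitely_generated_submonoid A G \<longleftrightarrow>
     submonoid A G \<and> (\<exists>B. finite B \<and> B \<subseteq> A \<and> A = submonoid_generated G B)"

text \<open>
  Elements of the type \<^typ>\<open>(nat \<Rightarrow>\<^sub>0 int) \<Rightarrow>\<^sub>0 'k\<close> are the finite sums \<open>\<Sum> c\<^sub>m x\<^sup>m\<close> with
  convolution as product, so \<open>k[A]\<close> consists of those with exponents in \<open>A\<close>.
\<close>

definition monoid_algebra ::
    "(nat \<Rightarrow>\<^sub>0 int) set \<Rightarrow> ((nat \<Rightarrow>\<^sub>0 int) \<Rightarrow>\<^sub>0 'k::field) set" where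
  "monoid_algebra A = {g. Poly_Mapping.keys g \<subseteq> A}"

text \<open>The image of \<open>k[A]\<close> in an algebraically closed field containing its fraction field.\<close>

definition monoid_algebra_ac ::
    "(nat \<Rightarrow>\<^sub>0 int) set \<Rightarrow> ((nat \<Rightarrow>\<^sub>0 int) \<Rightarrow>\<^sub>0 'k::field) fract alg_closure set" where
  "monoid_algebra_ac A = (\<lambda>g. to_ac (to_fract g)) ` monoid_algebra A"

end

theory Submission
  imports Defs "HOL-Algebra.Ring_Divisibility"
begin

(* Let R = k[A]. If R is F-pure and y = a / b is in the fraction field with y^p in R, then every
   local splitting \<phi> satisfies b * \<phi> y = \<phi> a = a, so \<phi> fixes y; hence y lies in every localization
   of R, and so in R. This direction holds for all domains. Conversely, if R is weakly normal then
   p m \<in> A implies m \<in> A for all m \<in> M, because x^m is in the fraction field. As k is perfect, R^(1/p)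
   is spanned by the monomials x^(a/p) with a \<in> A, and discarding those with a/p not in M gives an
   R-linear retraction onto R. In terms of the p-th power g = y^p, this retraction
   is the Cartier operator, which sends \<Sum> c_m x^m to \<Sum> (c_{pm})^(1/p) x^m. *)

section \<open>F-pure domains are weakly normal\<close>

text \<open>Zorn's lemma gives a \<open>P\<close> that is largest among the ideals containing
  \<open>I\<close> but not 1. A strictly larger ideal contains 1, so \<open>P\<close> is a maximal
  ideal and hence prime.\<close>

lemma (in cring) proper_ideal_in_primeideal:
  assumes I: "ideal I R" and "\<one> \<notin> I"
  obtains P where "primeideal P R" "I \<subseteq> P"
proof -
  let ?S = "{J. ideal J R \<and> I \<subseteq> J \<and> \<one> \<notin> J}"
  have "\<exists>P\<in>?S. \<forall>J\<in>?S. P \<subseteq> J \<longrightarrow> J = P"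
  proof (rule subset_Zorn_nonempty)
    show "?S \<noteq> {}"
      using assms by blast
  next
    fix C assume C: "C \<noteq> {}" "subset.chain ?S C"
    then have "subset.chain {J. ideal J R} C"
      by (auto simp: pred_on.chain_def)
    then have "ideal (\<Union>C) R"
      using chain_Union_is_ideal[of C] C(1) by simp
    then show "\<Union>C \<in> ?S"
      using C by (auto simp: pred_on.chain_def)
  qed
  then obtain P where "P \<in> ?S" and max: "\<forall>J\<in>?S. P \<subseteq> J \<longrightarrow> J = P"
    by (rule bexE)
  then have P: "ideal P R" "I \<subseteq> P" "\<one> \<notin> P"
    by simp_all
  have "maximalideal P R"
  proof (rule maximalidealI)
    show "J = P \<or> J = carrier R" if "ideal J R" "P \<subseteq> J" for J
      using bspec[OF max, of J] that P(2) ideal.one_imp_carrier[of J R] by auto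
  qed (use P in auto)
  then show thesis
    using that P(2) maximalideal_prime by blast
qed

lemma ring_of_type_algebra_simps [simp]:
  "carrier ring_of_type_algebra = UNIV"
  "\<one>\<^bsub>ring_of_type_algebra\<^esub> = 1"
  "\<zero>\<^bsub>ring_of_type_algebra\<^esub> = 0"
  "x \<otimes>\<^bsub>ring_of_type_algebra\<^esub> y = x * y"
  "x \<oplus>\<^bsub>ring_of_type_algebra\<^esub> y = x + y"
  by (simp_all add: ring_of_type_algebra_def)

lemma cring_carrier_update:
  fixes R :: "'a::comm_ring_1 set"
  assumes one: "1 \<in> R" and diff: "\<And>x y. x \<in> R \<Longrightarrow> y \<in> R \<Longrightarrow> x - y \<in> R"
    and mult: "\<And>x y. x \<in> R \<Longrightarrow> y \<in> R \<Longrightarrow> x * y \<in> R"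
  shows "cring (ring_of_type_algebra\<lparr>carrier := R\<rparr>)"
proof -
  have zero: "0 \<in> R"
    using diff[OF one one] by simp
  have neg: "- x \<in> R" if "x \<in> R" for x
    using diff[OF zero that] by simp
  have add: "x + y \<in> R" if "x \<in> R" "y \<in> R" for x y
    using diff[OF that(1) neg[OF that(2)]] by simp
  show ?thesis
    by (rule cringI; (rule abelian_groupI comm_monoidI)?)
      (use one mult zero add neg in
        \<open>auto simp: algebra_simps intro!: bexI[of _ "- _"]\<close>)
qed

lemma subset_localize_at: "S \<subseteq> localize_at f S"
  unfolding localize_at_def
proof
  fix x assume "x \<in> S"
  moreover have "x = x / f ^ 0"
    by simp
  ultimately show "x \<in> {y / f ^ n | y n. y \<in> S}"
    by blast
qed

lemma localize_at_1 [simp]: "localize_at 1 S = S"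
  by (simp add: localize_at_def)

text \<open>If \<open>y\<close> were outside \<open>R\<close>, its denominators would form a proper
  ideal, contained in some prime \<open>P\<close>. The splitting over a neighbourhood
  \<open>D(f)\<close> of \<open>P\<close> puts \<open>y\<close> into \<open>R[1/f]\<close>, so a
  power of \<open>f\<close> is a denominator of \<open>y\<close> and lies in \<open>P\<close>,
  contradicting primality.\<close>

lemma F_pure_imp_weakly_normal:
  fixes R :: "'w::alg_closed_field set"
  assumes one: "1 \<in> R" and diff: "\<And>x y. x \<in> R \<Longrightarrow> y \<in> R \<Longrightarrow> x - y \<in> R"
    and mult: "\<And>x y. x \<in> R \<Longrightarrow> y \<in> R \<Longrightarrow> x * y \<in> R"
    and pure: "F_pure p R"
  shows "weakly_normal p R"
proof -
  let ?R = "ring_of_type_algebra\<lparr>carrier := R\<rparr>"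
  interpret R: cring ?R
    by (rule cring_carrier_update) (use one diff mult in auto)
  have zero: "0 \<in> R"
    using diff[OF one one] by simp
  have neg: "- x \<in> R" if "x \<in> R" for x
    using diff[OF zero that] by simp
  have add: "x + y \<in> R" if "x \<in> R" "y \<in> R" for x y
    using diff[OF that(1) neg[OF that(2)]] by simp
  have power: "x ^ n \<in> R" if "x \<in> R" for x n
    by (induction n) (use that one mult in auto)
  have "y \<in> R" if y: "y \<in> root_ring p R" "y \<in> frac_field R" for y
  proof (rule ccontr)
    assume "y \<notin> R"
    \<comment> \<open>The ideal of denominators of \<open>y\<close>; it is proper because
      \<open>y\<close> is assumed to lie outside \<open>R\<close>.\<close>
    define I where "I = {r \<in> R. r * y \<in> R}"
    have neg_R: "\<ominus>\<^bsub>?R\<^esub> x = - x" if "x \<in> R" for x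
      by (rule R.minus_equality) (use that neg in simp_all)
    have "ideal I ?R"
    proof (rule idealI)
      show "ring ?R"
        by (rule R.ring_axioms)
      show "subgroup I (add_monoid ?R)"
      proof
        show "inv\<^bsub>add_monoid ?R\<^esub> x \<in> I" if "x \<in> I" for x
          using that neg neg_R[of x] by (auto simp: I_def a_inv_def)
      qed (auto simp: I_def zero algebra_simps intro: add)
      show "x \<otimes>\<^bsub>?R\<^esub> a \<in> I" "a \<otimes>\<^bsub>?R\<^esub> x \<in> I" if "a \<in> I" "x \<in> carrier ?R" for a x
        using that mult[of x a] mult[of x "a * y"] by (auto simp: I_def mult_ac)
    qed
    moreover have "\<one>\<^bsub>?R\<^esub> \<notin> I"
      using \<open>y \<notin> R\<close> by (simp add: I_def)
    ultimately obtain P where P: "primeideal P ?R" "I \<subseteq> P"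
      using R.proper_ideal_in_primeideal by blast
    then obtain f where f: "f \<in> R" "f \<notin> P"
      and "inclusion_splits (localize_at f R) (localize_at f (root_ring p R))"
      using pure unfolding F_pure_def by blast
    then obtain \<phi> where \<phi>_in: "\<And>y. y \<in> localize_at f (root_ring p R) \<Longrightarrow> \<phi> y \<in> localize_at f R"
      and \<phi>_mult: "\<And>a y. a \<in> localize_at f R \<Longrightarrow> y \<in> localize_at f (root_ring p R) \<Longrightarrow>
        \<phi> (a * y) = a * \<phi> y"
      and \<phi>_id: "\<And>a. a \<in> localize_at f R \<Longrightarrow> \<phi> a = a"
      unfolding inclusion_splits_def by blast
    interpret P: primeideal P ?R
      by (rule P)
    obtain a b where ab: "y = a / b" "a \<in> R" "b \<in> R" "b \<noteq> 0"
      using y(2) unfolding frac_field_def by blast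
    have "b * \<phi> y = \<phi> (b * y)"
      by (rule \<phi>_mult[symmetric]) (use subset_localize_at ab y(1) in blast)+
    also have "b * y = a"
      using ab by simp
    also have "\<phi> a = a"
      by (rule \<phi>_id) (use subset_localize_at ab in blast)
    finally have "\<phi> y = y"
      using ab(4) by (simp add: ab(1) eq_divide_eq mult.commute)
    moreover have "\<phi> y \<in> localize_at f R"
      by (rule \<phi>_in) (use subset_localize_at y(1) in blast)
    ultimately obtain r n where rn: "y = r / f ^ n" "r \<in> R"
      unfolding localize_at_def by auto
    have "f \<noteq> 0"
      using f P.zero_closed by auto
    then have "f ^ n \<in> I"
      using rn power[OF f(1)] by (simp add: I_def)
    then have "f ^ n \<in> P"
      using P(2) by blast
    moreover have "f ^ n \<notin> P"
    proof (induction n)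
      case 0
      then show ?case
        using P.one_imp_carrier P.I_notcarr by auto
    next
      case (Suc n)
      then show ?case
        using P.I_prime[of f "f ^ n"] f power by auto
    qed
    ultimately show False
      by blast
  qed
  moreover have "y \<in> root_ring p R \<inter> frac_field R" if "y \<in> R" for y
  proof
    show "y \<in> root_ring p R"
      using power[OF that] by (simp add: root_ring_def)
    have "y = y / 1"
      by simp
    then show "y \<in> frac_field R"
      unfolding frac_field_def using that one one_neq_zero by blast
  qed
  ultimately show ?thesis
    unfolding weakly_normal_def by blast
qed

text \<open>A global splitting serves every prime at once: take \<open>f = 1\<close>, which lies in
  no prime and changes nothing under localization.\<close>

lemma inclusion_splits_imp_F_pure:
  fixes R :: "'w::alg_closed_field set"
  assumes "1 \<in> R" and "inclusion_splits R (root_ring p R)"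
  shows "F_pure p R"
  unfolding F_pure_def
proof (intro allI impI)
  fix P assume "primeideal P (ring_of_type_algebra\<lparr>carrier := R\<rparr>)"
  then interpret P: primeideal P "ring_of_type_algebra\<lparr>carrier := R\<rparr>" .
  have "1 \<notin> P"
    using P.one_imp_carrier P.I_notcarr by auto
  then show "\<exists>f\<in>R - P. inclusion_splits (localize_at f R) (localize_at f (root_ring p R))"
    using assms by (intro bexI[of _ 1]) auto
qed

section \<open>The Cartier operator on Laurent polynomials\<close>

text \<open>Together with \<open>CHAR_poly_mapping\<close>, this carries the characteristic of the
  coefficient field up to the field containing \<open>k[A]\<close>, where p-th powers of sums must
  be expanded.\<close>

lemma CHAR_fract [simp]: "CHAR('a::idom fract) = CHAR('a)"
proof (rule CHAR_eqI)
  have of_nat: "of_nat n = to_fract (of_nat n :: 'a)" for n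
    by (induction n) simp_all
  show "of_nat CHAR('a) = (0 :: 'a fract)"
    by (simp add: of_nat)
  show "CHAR('a) dvd n" if "of_nat n = (0 :: 'a fract)" for n
    using that by (simp add: of_nat of_nat_eq_0_iff_char_dvd)
qed

text \<open>Natural numbers are constants, so their coefficient at exponent 0 decides whether they
  vanish.\<close>

lemma CHAR_poly_mapping [simp]:
  "CHAR('a::monoid_add \<Rightarrow>\<^sub>0 'k::semiring_1) = CHAR('k)"
proof (rule CHAR_eqI)
  show "of_nat CHAR('k) = (0 :: 'a \<Rightarrow>\<^sub>0 'k)"
    by (simp flip: single_of_nat)
  show "CHAR('k) dvd n" if "of_nat n = (0 :: 'a \<Rightarrow>\<^sub>0 'k)" for n
  proof -
    have "Poly_Mapping.lookup (of_nat n :: 'a \<Rightarrow>\<^sub>0 'k) 0 = 0"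
      using that by simp
    then show ?thesis
      by (simp add: lookup_of_nat of_nat_eq_0_iff_char_dvd)
  qed
qed

text \<open>Expanding \<open>(y + (x - y))^p\<close> leaves \<open>(x - y)^p = 0\<close>, and a
  domain has no nilpotents.\<close>

lemma frobenius_inj:
  fixes x y :: "'a::idom"
  assumes "CHAR('a) > 0" and "x ^ CHAR('a) = y ^ CHAR('a)"
  shows "x = y"
proof -
  have "x ^ CHAR('a) = (y + (x - y)) ^ CHAR('a)"
    by simp
  also have "\<dots> = y ^ CHAR('a) + (x - y) ^ CHAR('a)"
    by (rule freshmans_dream) (use assms prime_CHAR_semidom in auto)
  finally show ?thesis
    using assms by simp
qed

text \<open>In positive characteristic the root exists by algebraic closedness and is unique by
  \<open>frobenius_inj\<close>, so this is the inverse of Frobenius.\<close>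

definition frobenius_root :: "'k::alg_closed_field \<Rightarrow> 'k" where
  "frobenius_root x = (SOME y. y ^ CHAR('k) = x)"

lemma frobenius_root_power [simp]:
  assumes "CHAR('k::alg_closed_field) > 0"
  shows "frobenius_root (x :: 'k) ^ CHAR('k) = x"
  unfolding frobenius_root_def using nth_root_exists[OF assms] by (rule someI_ex)

text \<open>Exponents form a group, so only the pair \<open>(m, n - m)\<close> contributes to the
  convolution at \<open>n\<close>.\<close>

lemma lookup_single_mult:
  fixes g :: "'a::ab_group_add \<Rightarrow>\<^sub>0 'k::comm_semiring_1"
  shows "Poly_Mapping.lookup (Poly_Mapping.single m c * g) n = c * Poly_Mapping.lookup g (n - m)"
proof -
  have "Poly_Mapping.lookup (Poly_Mapping.single m c * g) n =
    (\<Sum>l. (c * Poly_Mapping.lookup g (n - m) when l = m))"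
  proof (unfold lookup_mult, rule Sum_any.cong)
    fix l
    have "(\<Sum>q. Poly_Mapping.lookup g q when n = l + q) =
      (\<Sum>q. Poly_Mapping.lookup g q when q = n - l)"
      by (rule Sum_any.cong) (auto simp: when_def algebra_simps)
    then show "Poly_Mapping.lookup (Poly_Mapping.single m c) l *
      (\<Sum>q. Poly_Mapping.lookup g q when n = l + q) =
      (c * Poly_Mapping.lookup g (n - m) when l = m)"
      by (simp add: lookup_single when_def)
  qed
  then show ?thesis
    by simp
qed

lemma inj_frag_cmul: "k \<noteq> 0 \<Longrightarrow> inj (frag_cmul k)"
  by (rule injI) (metis lookup_frag_cmul mult_cancel_left poly_mapping_eqI)

lemma single_power:
  "Poly_Mapping.single m (c :: 'k::comm_semiring_1) ^ n =
    Poly_Mapping.single (frag_cmul (int n) m) (c ^ n)"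
  by (induction n) (simp_all add: mult_single frag_cmul_distrib)

definition cartier ::
    "(('a \<Rightarrow>\<^sub>0 int) \<Rightarrow>\<^sub>0 'k::alg_closed_field) \<Rightarrow> (('a \<Rightarrow>\<^sub>0 int) \<Rightarrow>\<^sub>0 'k)" where
  "cartier g = Poly_Mapping.map frobenius_root (Poly_Mapping.map_key (frag_cmul (int CHAR('k))) g)"

context
  assumes char: "CHAR('k::alg_closed_field) > 0"
begin

lemma prime_char: "prime CHAR('k)"
  using prime_CHAR_semidom char by auto

text \<open>Raising coefficients to the p-th power removes the chosen root from all later
  computations.\<close>

lemma lookup_cartier_power:
  "Poly_Mapping.lookup (cartier (g :: ('a \<Rightarrow>\<^sub>0 int) \<Rightarrow>\<^sub>0 'k)) n ^ CHAR('k) =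
    Poly_Mapping.lookup g (frag_cmul (int CHAR('k)) n)"
proof -
  \<comment> \<open>\<open>map_key\<close> composes with its argument only if that is injective.
    \<open>map\<close> keeps zero coefficients at 0, which agrees with
    \<open>0^p = 0\<close>.\<close>
  have "inj (frag_cmul (int CHAR('k)) :: ('a \<Rightarrow>\<^sub>0 int) \<Rightarrow> _)"
    using char by (intro inj_frag_cmul) auto
  then show ?thesis
    using char
    by (simp add: cartier_def Poly_Mapping.map.rep_eq Poly_Mapping.map_key.rep_eq when_def)
qed

text \<open>Frobenius is injective on \<open>k\<close>, so the p-th powers of the coefficients
  determine \<open>cartier g\<close>.\<close>

lemma cartier_eqI:
  assumes "\<And>n. Poly_Mapping.lookup h n ^ CHAR('k) =
    Poly_Mapping.lookup g (frag_cmul (int CHAR('k)) n)"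
  shows "cartier (g :: ('a \<Rightarrow>\<^sub>0 int) \<Rightarrow>\<^sub>0 'k) = h"
  by (rule poly_mapping_eqI, rule frobenius_inj[OF char]) (simp add: lookup_cartier_power assms)

lemma cartier_add:
  "cartier (f + g :: ('a \<Rightarrow>\<^sub>0 int) \<Rightarrow>\<^sub>0 'k) = cartier f + cartier g"
  by (rule cartier_eqI)
    (simp add: lookup_add freshmans_dream prime_char lookup_cartier_power)

text \<open>The p-th power of \<open>c x^m\<close> is \<open>c^p x^(pm)\<close>, and shifting the
  exponent \<open>pn\<close> by \<open>pm\<close> gives \<open>p(n - m)\<close>, again a multiple of
  p.\<close>

lemma cartier_single_power_mult:
  "cartier (Poly_Mapping.single m c ^ CHAR('k) * g :: ('a \<Rightarrow>\<^sub>0 int) \<Rightarrow>\<^sub>0 'k) =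
    Poly_Mapping.single m c * cartier g"
proof (rule cartier_eqI)
  fix n
  have "frag_cmul k n - frag_cmul k m = frag_cmul k (n - m)" for k
    by (rule poly_mapping_eqI) (simp add: lookup_minus algebra_simps)
  then show "Poly_Mapping.lookup (Poly_Mapping.single m c * cartier g) n ^ CHAR('k) =
      Poly_Mapping.lookup (Poly_Mapping.single m c ^ CHAR('k) * g) (frag_cmul (int CHAR('k)) n)"
    by (simp add: single_power lookup_single_mult power_mult_distrib lookup_cartier_power)
qed

text \<open>Since \<open>(a y)^p = a^p y^p\<close>, this is linearity of the retraction expressed on
  p-th powers. Both sides are additive in \<open>f\<close>, which reduces the claim to
  monomials.\<close>

lemma cartier_power_mult:
  "cartier (f ^ CHAR('k) * g :: ('a \<Rightarrow>\<^sub>0 int) \<Rightarrow>\<^sub>0 'k) = f * cartier g"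
proof (induction f rule: update_induct)
  case const
  have "cartier 0 = (0 :: ('a \<Rightarrow>\<^sub>0 int) \<Rightarrow>\<^sub>0 'k)"
    using cartier_add[of 0 0] by simp
  then show ?case
    using char by (simp add: power_0_left)
next
  case (update f m c)
  \<comment> \<open>The induction supplies a new exponent \<open>m\<close> outside the support of
    \<open>f\<close>, so updating there is adding a monomial.\<close>
  then have "Poly_Mapping.update m c f = Poly_Mapping.single m c + f"
    by (intro poly_mapping_eqI) (auto simp: lookup_update lookup_add lookup_single in_keys_iff when_def)
  then show ?case
    by (simp add: freshmans_dream prime_char distrib_right cartier_add cartier_single_power_mult
        update.IH)
qed

text \<open>An element \<open>f\<close> of \<open>k[M]\<close> has p-th power \<open>f^p\<close>, so
  this says that the retraction fixes it. By linearity only \<open>f = 1\<close> needs a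
  computation.\<close>

lemma cartier_power:
  "cartier (f ^ CHAR('k) :: ('a \<Rightarrow>\<^sub>0 int) \<Rightarrow>\<^sub>0 'k) = f"
proof -
  have "cartier 1 = (1 :: ('a \<Rightarrow>\<^sub>0 int) \<Rightarrow>\<^sub>0 'k)"
    by (rule cartier_eqI) (use char in \<open>auto simp: lookup_one when_def\<close>)
  then show ?thesis
    using cartier_power_mult[of f 1] by simp
qed

lemma keys_cartier:
  "Poly_Mapping.keys (cartier (g :: ('a \<Rightarrow>\<^sub>0 int) \<Rightarrow>\<^sub>0 'k)) =
    {n. frag_cmul (int CHAR('k)) n \<in> Poly_Mapping.keys g}"
  using char by (auto simp: in_keys_iff simp flip: lookup_cartier_power)

end

section \<open>Monoid algebras\<close>

context
  fixes A :: "(nat \<Rightarrow>\<^sub>0 int) set" and d :: nat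
  assumes A: "submonoid A (lattice_group d)"
begin

lemma keys_subset: "m \<in> A \<Longrightarrow> Poly_Mapping.keys m \<subseteq> {..<d}"
  using submonoid.subset[OF A] by fastforce

lemma zero_in: "0 \<in> A"
  using submonoid.one_closed[OF A] by simp

lemma add_in: "m \<in> A \<Longrightarrow> n \<in> A \<Longrightarrow> m + n \<in> A"
  using submonoid.m_closed[OF A, of m n] by simp

lemma monoid_algebra_ac_one: "1 \<in> monoid_algebra_ac A"
  unfolding monoid_algebra_ac_def monoid_algebra_def
  by (rule image_eqI[of _ _ 1]) (auto simp: zero_in)

lemma monoid_algebra_ac_diff:
  assumes "x \<in> monoid_algebra_ac A" "y \<in> monoid_algebra_ac A"
  shows "x - y \<in> (monoid_algebra_ac A :: (_ \<Rightarrow>\<^sub>0 'k::field) fract alg_closure set)"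
proof -
  have "f - g \<in> monoid_algebra A"
    if "f \<in> monoid_algebra A" "g \<in> monoid_algebra A" for f g :: "_ \<Rightarrow>\<^sub>0 'k"
    using that by (auto simp: monoid_algebra_def in_keys_iff lookup_minus subset_iff) metis
  then show ?thesis
    using assms unfolding monoid_algebra_ac_def
    by (auto simp flip: to_ac_diff to_fract_diff)
qed

lemma monoid_algebra_ac_mult:
  assumes "x \<in> monoid_algebra_ac A" "y \<in> monoid_algebra_ac A"
  shows "x * y \<in> (monoid_algebra_ac A :: (_ \<Rightarrow>\<^sub>0 'k::field) fract alg_closure set)"
proof -
  have "f * g \<in> monoid_algebra A"
    if "f \<in> monoid_algebra A" "g \<in> monoid_algebra A" for f g :: "_ \<Rightarrow>\<^sub>0 'k"
    using that keys_mult[of f g] add_in unfolding monoid_algebra_def by blast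
  then show ?thesis
    using assms unfolding monoid_algebra_ac_def
    by (auto simp flip: to_ac_mult to_fract_mult)
qed

text \<open>The differences contain 0, \<open>A\<close> and its negatives, and are closed under
  addition by commutativity, so they exhaust the generated group.\<close>

lemma generated_differences:
  assumes "generate (lattice_group d) A = carrier (lattice_group d)"
    and "Poly_Mapping.keys m \<subseteq> {..<d}"
  obtains a b where "a \<in> A" "b \<in> A" "m = a - b"
proof -
  have "m \<in> generate (lattice_group d) A"
    using assms by simp
  then have "\<exists>a\<in>A. \<exists>b\<in>A. m = a - b"
  proof induction
    case one
    then show ?case
      using zero_in by force
  next
    case (incl h)
    then show ?case
      using zero_in by force
  next
    case (inv h)
    then show ?case
      using zero_in keys_subset by force
  next
    case (eng h1 h2)
    then obtain a b a' b' where "a \<in> A" "b \<in> A" "a' \<in> A" "b' \<in> A" "h1 = a - b" "h2 = a' - b'"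
      by blast
    then show ?case
      by (intro bexI[of _ "a + a'"] bexI[of _ "b + b'"]) (auto intro: add_in)
  qed
  then show thesis
    using that by blast
qed

lemma weakly_normal_imp_root_closed:
  assumes gen: "generate (lattice_group d) A = carrier (lattice_group d)"
    and normal: "weakly_normal p
      (monoid_algebra_ac A :: ((nat \<Rightarrow>\<^sub>0 int) \<Rightarrow>\<^sub>0 'k::field) fract alg_closure set)"
    and "p > 0" and m: "frag_cmul (int p) m \<in> A"
  shows "m \<in> A"
proof -
  let ?X = "\<lambda>m. to_ac (to_fract (Poly_Mapping.single m (1 :: 'k)))"
  have to_fract_power: "to_fract (f ^ n) = to_fract f ^ n" for f :: "(nat \<Rightarrow>\<^sub>0 int) \<Rightarrow>\<^sub>0 'k" and n
    by (induction n) simp_all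
  \<comment> \<open>Both embeddings are injective and the monomial has support
    \<open>{n}\<close>.\<close>
  have X_in: "?X n \<in> monoid_algebra_ac A \<longleftrightarrow> n \<in> A" for n
    by (auto simp: monoid_algebra_ac_def monoid_algebra_def)
  \<comment> \<open>The type of \<open>m\<close> allows coordinates beyond \<open>d\<close>;
    multiplication by \<open>p > 0\<close> preserves the support, so \<open>m\<close> lies in the
    lattice.\<close>
  have "Poly_Mapping.keys m \<subseteq> {..<d}"
    using keys_subset[OF m] \<open>p > 0\<close> by (auto simp: subset_iff)
  then obtain a b where ab: "a \<in> A" "b \<in> A" "m = a - b"
    using generated_differences[OF gen] by blast
  have "?X m * ?X b = ?X a"
    by (simp add: ab(3) mult_single flip: to_ac_mult to_fract_mult)
  moreover have "?X b \<noteq> 0"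
    by (metis lookup_single_eq lookup_zero one_neq_zero to_ac_eq_0_iff to_fract_eq_0_iff)
  ultimately have "?X m = ?X a / ?X b"
    by (simp add: field_simps)
  then have "?X m \<in> frac_field (monoid_algebra_ac A)"
    unfolding frac_field_def using X_in ab \<open>?X b \<noteq> 0\<close> by blast
  moreover have "?X m \<in> root_ring p (monoid_algebra_ac A)"
    using X_in[of "frag_cmul (int p) m"] m
    by (simp add: root_ring_def single_power flip: to_ac_power to_fract_power)
  ultimately show ?thesis
    using normal X_in unfolding weakly_normal_def by blast
qed

text \<open>The splitting sends \<open>y\<close> to the Cartier operator applied to
  \<open>y^p\<close>. Root-closedness of \<open>A\<close> keeps the values in
  \<open>k[A]\<close>.\<close>

lemma root_closed_imp_inclusion_splits:
  assumes char: "CHAR('k::alg_closed_field) > 0"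
    and closed: "\<And>m. frag_cmul (int CHAR('k)) m \<in> A \<Longrightarrow> m \<in> A"
  defines "R \<equiv> monoid_algebra_ac A :: ((nat \<Rightarrow>\<^sub>0 int) \<Rightarrow>\<^sub>0 'k) fract alg_closure set"
  shows "inclusion_splits R (root_ring CHAR('k) R)"
proof -
  let ?\<iota> = "\<lambda>f :: (nat \<Rightarrow>\<^sub>0 int) \<Rightarrow>\<^sub>0 'k. to_ac (to_fract f)"
  have power: "?\<iota> f ^ n = ?\<iota> (f ^ n)" for f n
    by (induction n) simp_all
  \<comment> \<open>The root \<open>y\<close> itself need not come from \<open>k[M]\<close>, but
    \<open>y^p\<close> does, and \<open>inv_into\<close> recovers it as a Laurent
    polynomial.\<close>
  define \<phi> where "\<phi> = (\<lambda>y. ?\<iota> (cartier (inv_into UNIV ?\<iota> (y ^ CHAR('k)))))"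
  have \<phi>_eq: "\<phi> y = ?\<iota> (cartier g)" if "y ^ CHAR('k) = ?\<iota> g" for y g
    using that inv_f_f[of ?\<iota> g] by (simp add: \<phi>_def inj_def)
  have R: "R = ?\<iota> ` monoid_algebra A"
    by (simp add: R_def monoid_algebra_ac_def)
  have root: "\<exists>g\<in>monoid_algebra A. y ^ CHAR('k) = ?\<iota> g" if "y \<in> root_ring CHAR('k) R" for y
    using that by (auto simp: root_ring_def R)
  show ?thesis
    unfolding inclusion_splits_def
  proof (intro exI[of _ \<phi>] conjI ballI)
    fix y assume "y \<in> root_ring CHAR('k) R"
    then obtain g where g: "g \<in> monoid_algebra A" "y ^ CHAR('k) = ?\<iota> g"
      using root by blast
    have "cartier g \<in> monoid_algebra A"
      using g(1) closed by (auto simp: monoid_algebra_def keys_cartier[OF char])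
    then show "\<phi> y \<in> R"
      by (simp add: \<phi>_eq[OF g(2)] R)
  next
    fix x y assume "x \<in> root_ring CHAR('k) R" "y \<in> root_ring CHAR('k) R"
    then obtain f g where f: "x ^ CHAR('k) = ?\<iota> f" and g: "y ^ CHAR('k) = ?\<iota> g"
      using root by meson
    \<comment> \<open>The freshman's dream is applied in the large field, whose characteristic is
      that of \<open>k\<close>.\<close>
    have "(x + y) ^ CHAR('k) = ?\<iota> (f + g)"
      by (simp add: f g freshmans_dream prime_char[OF char])
    from \<phi>_eq[OF this] show "\<phi> (x + y) = \<phi> x + \<phi> y"
      by (simp add: \<phi>_eq[OF f] \<phi>_eq[OF g] cartier_add[OF char])
  next
    fix a y assume "a \<in> R" "y \<in> root_ring CHAR('k) R"
    then obtain f g where f: "a = ?\<iota> f" and g: "y ^ CHAR('k) = ?\<iota> g"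
      using root R by blast
    have "(a * y) ^ CHAR('k) = ?\<iota> (f ^ CHAR('k) * g)"
      by (simp add: f g power power_mult_distrib del: to_ac_power)
    from \<phi>_eq[OF this] show "\<phi> (a * y) = a * \<phi> y"
      by (simp add: f \<phi>_eq[OF g] cartier_power_mult[OF char])
  next
    fix a assume "a \<in> R"
    then obtain f where f: "a = ?\<iota> f"
      using R by blast
    then show "\<phi> a = a"
      by (simp add: \<phi>_eq[OF power] cartier_power[OF char])
  qed
qed

end

theorem proposition5p3:
  fixes d p :: nat and A :: "(nat \<Rightarrow>\<^sub>0 int) set"
  defines "M \<equiv> lattice_group d"
  assumes "p > 0" and "CHAR('k::alg_closed_field) = p"
    and "finitely_generated_submonoid A M"
    and "generate M A = carrier M"
    and "\<And>H. subgroup H M \<Longrightarrow> H \<subseteq> A \<Longrightarrow> H = {\<one>\<^bsub>M\<^esub>}"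
  shows "F_pure p (monoid_algebra_ac A :: ((nat \<Rightarrow>\<^sub>0 int) \<Rightarrow>\<^sub>0 'k) fract alg_closure set)
    \<longleftrightarrow> weakly_normal p (monoid_algebra_ac A :: ((nat \<Rightarrow>\<^sub>0 int) \<Rightarrow>\<^sub>0 'k) fract alg_closure set)"
    (is "F_pure p ?R \<longleftrightarrow> _")
proof
  have A: "submonoid A (lattice_group d)"
    using assms by (simp add: finitely_generated_submonoid_def)
  note ring = monoid_algebra_ac_one[OF A] monoid_algebra_ac_diff[OF A] monoid_algebra_ac_mult[OF A]
  show "weakly_normal p ?R" if "F_pure p ?R"
    using F_pure_imp_weakly_normal[OF ring that] .
  assume normal: "weakly_normal p ?R"
  have "inclusion_splits ?R (root_ring CHAR('k) ?R)"
  proof (rule root_closed_imp_inclusion_splits[OF A])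
    show "m \<in> A" if "frag_cmul (int CHAR('k)) m \<in> A" for m
      using weakly_normal_imp_root_closed[OF A _ normal \<open>p > 0\<close>] that assms by simp
  qed (use assms in simp)
  then show "F_pure p ?R"
    using inclusion_splits_imp_F_pure[OF ring(1)] assms by simp
qed

end
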